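(* Let $d=3$, let $\varepsilon>0$, and put $n=\lceil 1/\varepsilon\rceil$. Suppose it is known in advance that the (otherwise unknown) collection of preference sets $\{A_{ij}\}_{i,j\in\{1,2,3\}}$ on the triangle $A$ has the following property: each $A_{ij}$ is a convex set containing $F_j$. Then an $\varepsilon$-fair division point can be found in binary mode with at most $$6\left(\lceil\log_2 n\rceil^2+\lceil\log_2 n\rceil\right)=O(\log^2 n)$$ queries. That is, there is an adaptive algorithm in binary mode which, for every collection with this property, makes at most this many queries and outputs an $\varepsilon$-fair division point.
   Context: Let $A$ be a regular triangle with edges of Euclidean length $1$ in $\mathbb{R}^{2}$, with vertices $v_1,v_2,v_3$. Each $x\in A$ is written in barycentric coordinates as $x=[\alpha_1,\alpha_2,\alpha_3]=\sum_i\alpha_i v_i$ with $\alpha_i\ge 0$, $\sum_i\alpha_i=1$. $F_j$ denotes the side of $A$ opposite to $v_j$, i.e. the convex hull of $\{v_k\}_{k\ne j}$. The metric is $\operatorname{dist}([\alpha_1,\alpha_2,\alpha_3],[\alpha'_1,\alpha'_2,\alpha'_3])=\max_i|\alpha_i-\alpha'_i|$ (extended to $\mathbb{R}^{2}$ by the same formula in affine barycentric coordinates). Preference sets: a collection $\{A_{ij}\}_{i,j\in\{1,2,3\}}$ of closed subsets of $A$ such that for each $i$ (an agent) $A_{i1}\cup A_{i2}\cup A_{i3}=A$. For $\varepsilon\ge 0$ put $A^{\varepsilon}_{ij}=\{x\in\mathbb{R}^{2}:\operatorname{dist}(x,A_{ij})\le\varepsilon\}$. A point $x\in A$ is an $\varepsilon$-fair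 division point if there is a permutation $\sigma$ of $\{1,2,3\}$ with $x\in A^{\varepsilon}_{i\sigma(i)}$ for all $i$. Query model: the sets $A_{ij}$ are fixed but unknown to the algorithm. A query in binary mode consists of choosing indices $i,j\in\{1,2,3\}$ and a point $x\in A$; the answer is "yes" if $x\in A_{ij}$ and "no" otherwise. Each query may depend on the previous answers, and after its queries the algorithm outputs a point of $A$ depending only on $\varepsilon$ and the answers received. Only the number of queries is counted. *)

theory Defs
  imports "HOL-Analysis.Analysis" "HOL-Library.Landau_Symbols"
begin

text \<open>Agents and vertices are both indexed by the three-element type \<open>3\<close>, whose elements
  are \<open>1\<close>, \<open>2\<close> and \<open>3 = 0\<close>.\<close>

definition regular_triangle :: "(3 \<Rightarrow> real^2) \<Rightarrow> bool" where
  "regular_triangle v \<longleftrightarrow> (\<forall>i j. i \<noteq> j \<longrightarrow> dist (v i) (v j) = 1)"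

definition triangle_of :: "(3 \<Rightarrow> real^2) \<Rightarrow> (real^2) set" where
  "triangle_of v = convex hull (range v)"

definition side :: "(3 \<Rightarrow> real^2) \<Rightarrow> 3 \<Rightarrow> (real^2) set" where
  "side v j = convex hull (v ` {k. k \<noteq> j})"

text \<open>Affine barycentric coordinates of an arbitrary point of the plane (possibly negative
  outside the triangle); unique because the vertices are affinely independent.\<close>

definition bary :: "(3 \<Rightarrow> real^2) \<Rightarrow> real^2 \<Rightarrow> 3 \<Rightarrow> real" where
  "bary v x = (THE a. (\<Sum>i\<in>UNIV. a i) = 1 \<and> (\<Sum>i\<in>UNIV. a i *\<^sub>R v i) = x)"

definition bdist :: "(3 \<Rightarrow> real^2) \<Rightarrow> real^2 \<Rightarrow> real^2 \<Rightarrow> real" where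
  "bdist v x y = (MAX i. \<bar>bary v x i - bary v y i\<bar>)"

text \<open>The nonemptiness guard implements the convention that the distance to the empty set is
  infinite; the real-valued infimum over the empty set would be unspecified.\<close>

definition neighbourhood :: "(3 \<Rightarrow> real^2) \<Rightarrow> real \<Rightarrow> (real^2) set \<Rightarrow> (real^2) set" where
  "neighbourhood v \<epsilon> S = {x. S \<noteq> {} \<and> (INF y\<in>S. bdist v x y) \<le> \<epsilon>}"

definition preference_sets :: "(3 \<Rightarrow> real^2) \<Rightarrow> (3 \<Rightarrow> 3 \<Rightarrow> (real^2) set) \<Rightarrow> bool" where
  "preference_sets v P \<longleftrightarrow>
     (\<forall>i j. closed (P i j) \<and> P i j \<subseteq> triangle_of v) \<and> (\<forall>i. (\<Union>j. P i j) = triangle_of v)"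

definition fair_division_point ::
    "(3 \<Rightarrow> real^2) \<Rightarrow> (3 \<Rightarrow> 3 \<Rightarrow> (real^2) set) \<Rightarrow> real \<Rightarrow> real^2 \<Rightarrow> bool" where
  "fair_division_point v P \<epsilon> x \<longleftrightarrow>
     x \<in> triangle_of v \<and> (\<exists>\<sigma>. \<sigma> permutes UNIV \<and> (\<forall>i. x \<in> neighbourhood v \<epsilon> (P i (\<sigma> i))))"

text \<open>An adaptive algorithm in binary mode is a decision tree. \<open>Query i j x T F\<close> asks
  whether \<open>x\<close> lies in the \<open>j\<close>-th set of agent \<open>i\<close> and continues with \<open>T\<close> on ``yes'' and
  with \<open>F\<close> on ``no''.\<close>

datatype algorithm =
    Output "real^2"
  | Query 3 3 "real^2" algorithm algorithm

primrec points_in :: "(real^2) set \<Rightarrow> algorithm \<Rightarrow> bool" where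
  "points_in A (Output x) \<longleftrightarrow> x \<in> A"
| "points_in A (Query i j x T F) \<longleftrightarrow> x \<in> A \<and> points_in A T \<and> points_in A F"

primrec run :: "(3 \<Rightarrow> 3 \<Rightarrow> (real^2) set) \<Rightarrow> algorithm \<Rightarrow> real^2" where
  "run P (Output x) = x"
| "run P (Query i j x T F) = (if x \<in> P i j then run P T else run P F)"

primrec num_queries :: "(3 \<Rightarrow> 3 \<Rightarrow> (real^2) set) \<Rightarrow> algorithm \<Rightarrow> nat" where
  "num_queries P (Output x) = 0"
| "num_queries P (Query i j x T F) =
     Suc (if x \<in> P i j then num_queries P T else num_queries P F)"

end

theory Submission imports Defs begin

text \<open>Cut the triangle into grid rows \<open>\<alpha>\<^sub>1 = p/n\<close>. By convexity, on such a row agent \<open>i\<close> accepts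
  piece 2 on an initial run of grid points, up to index \<open>a i\<close>, and piece 3 on a final run, from
  index \<open>b i\<close> on; in between the agent must accept piece 1. Bisection finds the \<open>a i\<close> and \<open>b i\<close> of
  one row with \<open>6 \<lceil>log\<^sub>2 n\<rceil>\<close> queries. Call a row compatible if \<open>b j \<le> a i + 1\<close> for some
  \<open>i \<noteq> j\<close>. The side \<open>F\<^sub>1\<close>, where every agent accepts piece 1, may be treated as incompatible, whereas
  the vertex opposite to it is compatible, so a second bisection over \<open>p\<close> meets an incompatible row
  directly below a compatible one. A finite case analysis then shows that in the strip between two
  such rows some grid point has, within distance \<open>1/n\<close>, points where the three agents accept three
  different pieces. The bisection over \<open>p\<close> need not locate a unique change, so no monotonicity
  in \<open>p\<close> is required.\<close>

section \<open>Decision trees\<close>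

text \<open>Continuation-passing form: the tree may go on with any continuation that receives the
  computed value, so that composition only adds the query counts.\<close>

definition computable :: "(real^2) set \<Rightarrow> nat \<Rightarrow> ((3 \<Rightarrow> 3 \<Rightarrow> (real^2) set) \<Rightarrow> 'a) \<Rightarrow> bool" where
  "computable A k f \<longleftrightarrow>
     (\<forall>c. (\<forall>y. points_in A (c y)) \<longrightarrow>
        (\<exists>alg. points_in A alg \<and>
           (\<forall>P. run P alg = run P (c (f P)) \<and> num_queries P alg \<le> k + num_queries P (c (f P)))))"

lemma computable_const: "computable A k (\<lambda>P. y)"
  unfolding computable_def using le_add2 by blast

lemma computable_query:
  assumes "x \<in> A"
  shows "computable A 1 (\<lambda>P. x \<in> P i j)"
  unfolding computable_def
proof (intro allI impI)
  fix c :: "bool \<Rightarrow> algorithm" assume "\<forall>y. points_in A (c y)"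
  then show "\<exists>alg. points_in A alg \<and> (\<forall>P. run P alg = run P (c (x \<in> P i j)) \<and>
                num_queries P alg \<le> 1 + num_queries P (c (x \<in> P i j)))"
    using assms by (intro exI[of _ "Query i j x (c True) (c False)"]) auto
qed

text \<open>For each value y a tree running \<open>g y\<close> and then \<open>c\<close> is chosen;
  handing this family to \<open>f\<close> as its continuation grafts these trees onto its
  leaves.\<close>

lemma computable_bind:
  fixes g :: "'a \<Rightarrow> (3 \<Rightarrow> 3 \<Rightarrow> (real^2) set) \<Rightarrow> 'b"
  assumes f: "computable A k f" and g: "\<And>y. computable A l (g y)"
  shows "computable A (k + l) (\<lambda>P. g (f P) P)"
  unfolding computable_def
proof (intro allI impI)
  fix c :: "'b \<Rightarrow> algorithm" assume c: "\<forall>z. points_in A (c z)"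
  have "\<forall>y. \<exists>alg. points_in A alg \<and>
          (\<forall>P. run P alg = run P (c (g y P)) \<and> num_queries P alg \<le> l + num_queries P (c (g y P)))"
    using g c unfolding computable_def by blast
  then obtain d where d: "\<And>y. points_in A (d y)"
      "\<And>y P. run P (d y) = run P (c (g y P))"
      "\<And>y P. num_queries P (d y) \<le> l + num_queries P (c (g y P))"
    by metis
  from f d(1) obtain alg where alg: "points_in A alg" "\<And>P. run P alg = run P (d (f P))"
      "\<And>P. num_queries P alg \<le> k + num_queries P (d (f P))"
    unfolding computable_def by meson
  have "num_queries P alg \<le> k + l + num_queries P (c (g (f P) P))" for P
    using alg(3)[of P] d(3)[of P "f P"] by linarith
  then show "\<exists>alg. points_in A alg \<and> (\<forall>P. run P alg = run P (c (g (f P) P)) \<and>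
               num_queries P alg \<le> k + l + num_queries P (c (g (f P) P)))"
    using alg d(2) by auto
qed

lemma computable_map: "computable A k f \<Longrightarrow> computable A k (\<lambda>P. h (f P))"
  using computable_bind[of A k f 0 "\<lambda>y P. h y"] by (simp add: computable_const)

lemma computable_Pair:
  assumes "computable A k f" "computable A l g"
  shows "computable A (k + l) (\<lambda>P. (f P, g P))"
  using computable_bind[OF assms(1), of l "\<lambda>y P. (y, g P)"] computable_map[OF assms(2)]
  by blast

lemma computable_fun3:
  fixes f :: "3 \<Rightarrow> (3 \<Rightarrow> 3 \<Rightarrow> (real^2) set) \<Rightarrow> 'a"
  assumes "\<And>i. computable A k (f i)"
  shows "computable A (3 * k) (\<lambda>P i. f i P)"
proof -
  define h :: "'a \<times> 'a \<times> 'a \<Rightarrow> 3 \<Rightarrow> 'a" where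
    "h = (\<lambda>(x, y, z) i. if i = 1 then x else if i = 2 then y else z)"
  have "computable A (k + (k + k)) (\<lambda>P. h (f 1 P, f 2 P, f 3 P))"
    by (rule computable_map[where h = h, OF computable_Pair[OF assms computable_Pair[OF assms assms]]])
  moreover have "h (f 1 P, f 2 P, f 3 P) = (\<lambda>i. f i P)" for P
  proof
    fix i :: 3 show "h (f 1 P, f 2 P, f 3 P) i = f i P"
      using exhaust_3[of i] by (auto simp: h_def)
  qed
  ultimately show ?thesis by (simp add: numeral_3_eq_3)
qed

section \<open>Bisection\<close>

text \<open>The arguments \<open>b\<close> and \<open>c\<close> carry the values of \<open>t\<close> at the two ends, so that they need not
  be computed again once the search is over.\<close>

function bisect ::
    "('a \<Rightarrow> bool) \<Rightarrow> (nat \<Rightarrow> 'a) \<Rightarrow> nat \<Rightarrow> 'a \<Rightarrow> nat \<Rightarrow> 'a \<Rightarrow> nat \<times> 'a \<times> 'a" where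
  "bisect D t lo b hi c =
     (if hi \<le> Suc lo then (lo, b, c)
      else let m = (lo + hi) div 2
           in if D (t m) then bisect D t m (t m) hi c else bisect D t lo b m (t m))"
  by auto
termination by (relation "Wellfounded.measure (\<lambda>(D, t, lo, b, hi, c). hi - lo)") auto

declare bisect.simps [simp del]

lemma bisect_stop: "hi \<le> Suc lo \<Longrightarrow> bisect D t lo b hi c = (lo, b, c)"
  by (subst bisect.simps) simp

lemma bisect_step:
  "\<not> hi \<le> Suc lo \<Longrightarrow> m = (lo + hi) div 2 \<Longrightarrow> bisect D t lo b hi c =
     (if D (t m) then bisect D t m (t m) hi c else bisect D t lo b m (t m))"
  by (subst bisect.simps) (simp add: Let_def)

text \<open>Each probe replaces the end whose property it satisfies, so \<open>I\<close> survives on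
  the left and \<open>J\<close> on the right. Monotonicity of \<open>D (t m)\<close> in
  \<open>m\<close> never enters, so the search over rows can use this too.\<close>

lemma bisect_invariant:
  assumes "lo < hi" "I lo b" "J hi c"
    and "\<And>m. lo < m \<Longrightarrow> m < hi \<Longrightarrow> D (t m) \<Longrightarrow> I m (t m)"
    and "\<And>m. lo < m \<Longrightarrow> m < hi \<Longrightarrow> \<not> D (t m) \<Longrightarrow> J m (t m)"
    and "bisect D t lo b hi c = (s, b', c')"
  shows "lo \<le> s \<and> s < hi \<and> I s b' \<and> J (Suc s) c'"
  using assms
proof (induction D t lo b hi c rule: bisect.induct)
  case (1 D t lo b hi c)
  show ?case
  proof (cases "hi \<le> Suc lo")
    case True
    then have "hi = Suc lo" using "1.prems"(1) by simp
    then show ?thesis using "1.prems" by (auto simp: bisect_stop)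
  next
    case False
    define m where "m = (lo + hi) div 2"
    have m: "lo < m" "m < hi" using False unfolding m_def by auto
    show ?thesis
    proof (cases "D (t m)")
      case True
      then have "bisect D t m (t m) hi c = (s, b', c')"
        using "1.prems"(6) bisect_step[OF False m_def, of D t b c] by simp
      then have "m \<le> s \<and> s < hi \<and> I s b' \<and> J (Suc s) c'"
        using m True "1.prems"(1-5) by (intro "1.IH"(1)[OF False m_def]) auto
      then show ?thesis using m by auto
    next
      case nD: False
      then have "bisect D t lo b m (t m) = (s, b', c')"
        using "1.prems"(6) bisect_step[OF False m_def, of D t b c] by simp
      then have "lo \<le> s \<and> s < m \<and> I s b' \<and> J (Suc s) c'"
        using m nD "1.prems"(1-5) by (intro "1.IH"(2)[OF False m_def]) auto
      then show ?thesis using m by auto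
    qed
  qed
qed

lemma computable_bisect:
  assumes "hi \<le> lo + 2 ^ L"
    and "\<And>m. lo < m \<Longrightarrow> m < hi \<Longrightarrow> computable A k (t m)"
  shows "computable A (L * k) (\<lambda>P. bisect D (\<lambda>m. t m P) lo b hi c)"
  using assms
proof (induction L arbitrary: lo b hi c)
  case 0
  then show ?case by (simp add: bisect_stop computable_const)
next
  case (Suc L)
  show ?case
  proof (cases "hi \<le> Suc lo")
    case True
    then show ?thesis by (simp add: bisect_stop computable_const)
  next
    case False
    define m where "m = (lo + hi) div 2"
    \<comment> \<open>Both halves of an interval of length at most \<open>2 ^ Suc L\<close> have
      length at most \<open>2 ^ L\<close>, also after rounding.\<close>
    have m: "lo < m" "m < hi" "hi \<le> m + 2 ^ L" "m \<le> lo + 2 ^ L"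
      using False Suc.prems(1) unfolding m_def by auto
    define g where "g = (\<lambda>r P. if D r then bisect D (\<lambda>m. t m P) m r hi c
                                else bisect D (\<lambda>m. t m P) lo b m r)"
    have "computable A k (t m)"
      using Suc.prems(2) m by blast
    moreover have "computable A (L * k) (g r)" for r
      unfolding g_def using Suc.IH[OF m(3)] Suc.IH[OF m(4)] Suc.prems(2) m(1,2) by (cases "D r") auto
    ultimately have "computable A (k + L * k) (\<lambda>P. g (t m P) P)"
      by (rule computable_bind)
    moreover have "bisect D (\<lambda>m. t m P) lo b hi c = g (t m P) P" for P
      using bisect_step[OF False m_def, of D "\<lambda>m. t m P" b c] by (simp add: g_def)
    ultimately show ?thesis by simp
  qed
qed

section \<open>Labelled grid rows\<close>

text \<open>The pair \<open>(p, q)\<close> stands for the grid point with barycentric coordinates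
  \<open>[p/n, q/n, (n-p-q)/n]\<close>, and \<open>S i j p q\<close> says that it belongs to the \<open>j\<close>-th set of agent \<open>i\<close>.\<close>

definition adjacent :: "nat \<Rightarrow> nat \<times> nat \<Rightarrow> nat \<times> nat \<Rightarrow> bool" where
  "adjacent n = (\<lambda>(p, q) (p', q'). p + q \<le> n \<and> p' + q' \<le> n \<and> p \<le> Suc p' \<and> p' \<le> Suc p \<and>
     q \<le> Suc q' \<and> q' \<le> Suc q \<and> p + q \<le> Suc (p' + q') \<and> p' + q' \<le> Suc (p + q))"

definition grid_fair :: "(3 \<Rightarrow> 3 \<Rightarrow> nat \<Rightarrow> nat \<Rightarrow> bool) \<Rightarrow> nat \<Rightarrow> nat \<times> nat \<Rightarrow> bool" where
  "grid_fair S n x \<longleftrightarrow> (\<exists>i j k. i \<noteq> j \<and> i \<noteq> k \<and> j \<noteq> k \<and>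
     (\<exists>p q. adjacent n x (p, q) \<and> S i 2 p q) \<and>
     (\<exists>p q. adjacent n x (p, q) \<and> S j 3 p q) \<and>
     (\<exists>p q. adjacent n x (p, q) \<and> S k 1 p q))"

definition row_labels :: "(3 \<Rightarrow> 3 \<Rightarrow> nat \<Rightarrow> nat \<Rightarrow> bool) \<Rightarrow> nat \<Rightarrow> nat \<Rightarrow> (3 \<Rightarrow> nat) \<times> (3 \<Rightarrow> nat) \<Rightarrow> bool" where
  "row_labels S n p = (\<lambda>(a, b). \<forall>i. p + a i \<le> n \<and> p + b i \<le> n \<and>
     (\<forall>q. p + q \<le> n \<longrightarrow> (q \<le> a i \<longrightarrow> S i 2 p q) \<and> (b i \<le> q \<longrightarrow> S i 3 p q) \<and>
        (a i < q \<longrightarrow> q < b i \<longrightarrow> S i 1 p q)))"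

text \<open>With \<open>b j \<le> a i\<close> in place of \<open>b j \<le> a i + 1\<close> the strip lemma below would fail: if all three
  agents pass from piece 2 to piece 3 between the same two grid points of the lower row, no grid
  point of that row is known to be acceptable with piece 1.\<close>

definition compatible :: "(3 \<Rightarrow> nat) \<times> (3 \<Rightarrow> nat) \<Rightarrow> bool" where
  "compatible = (\<lambda>(a, b). \<exists>i j. i \<noteq> j \<and> b j \<le> Suc (a i))"

lemma grid_fairI:
  assumes "distinct [i, j, k]"
    and "adjacent n x (p, q)" "S i 2 p q"
    and "adjacent n x (p', q')" "S j 3 p' q'"
    and "adjacent n x (p'', q'')" "S k 1 p'' q''"
  shows "grid_fair S n x"
  using assms unfolding grid_fair_def by (metis distinct_length_2_or_more)

lemma third_index: "\<exists>k :: 3. k \<noteq> i \<and> k \<noteq> j"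
proof -
  have "card {i, j} < CARD(3)" using card_insert_le_m1[of 2 "{j}" i] by simp
  then have "{i, j} \<noteq> UNIV" by auto
  then show ?thesis by blast
qed

text \<open>The point must be read off from the labels, all that the algorithm knows; hence
  \<open>S\<close> is quantified inside. If \<open>i\<close>, \<open>j\<close> witness compatibility
  of the upper row, then \<open>i\<close> takes piece 2 or \<open>j\<close> takes piece 3 there, and
  piece 1 is found in the lower row.\<close>

lemma strip_fair:
  assumes "\<not> compatible (a', b')" "compatible (a, b)"
  shows "\<exists>x. fst x + snd x \<le> n \<and>
    (\<forall>S. row_labels S n p (a', b') \<longrightarrow> row_labels S n (Suc p) (a, b) \<longrightarrow> grid_fair S n x)"
proof (cases "\<exists>S. row_labels S n p (a', b') \<and> row_labels S n (Suc p) (a, b)")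
  case False
  then show ?thesis by (intro exI[of _ "(0, 0)"]) auto
next
  case True
  then have R: "p + a' i \<le> n" "p + b' i \<le> n" "Suc p + a i \<le> n" "Suc p + b i \<le> n" for i
    by (auto simp: row_labels_def)
  obtain i j where ij: "i \<noteq> j" "b j \<le> Suc (a i)"
    using assms(2) by (auto simp: compatible_def)
  obtain k where k: "k \<noteq> i" "k \<noteq> j" using third_index by blast
  have sep: "a' x + 2 \<le> b' y" if "x \<noteq> y" for x y
    using assms(1) that by (fastforce simp: compatible_def not_le)
  note sep' = sep[OF ij(1)] sep[OF ij(1)[symmetric]] sep[OF k(1)] sep[OF k(2)]
    sep[OF k(1)[symmetric]] sep[OF k(2)[symmetric]]
  define good where "good = (\<lambda>x. fst x + snd x \<le> n \<and>
    (\<forall>S. row_labels S n p (a', b') \<longrightarrow> row_labels S n (Suc p) (a, b) \<longrightarrow> grid_fair S n x))"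
  define two where "two = (\<lambda>x r q. r = p \<and> q \<le> a' x \<or> r = Suc p \<and> q \<le> a x)"
  define three where "three = (\<lambda>x r q. r = p \<and> b' x \<le> q \<or> r = Suc p \<and> b x \<le> q)"
  have goodI: "good (p, q)"
    if "distinct [x, y, z]" "adjacent n (p, q) (r2, q2)" "two x r2 q2"
      "adjacent n (p, q) (r3, q3)" "three y r3 q3" "adjacent n (p, q) (p, q1)" "a' z < q1" "q1 < b' z"
    for q x y z r2 q2 r3 q3 q1
    unfolding good_def
  proof (intro conjI allI impI)
    show "fst (p, q) + snd (p, q) \<le> n" using that(2) by (simp add: adjacent_def)
    fix S assume S: "row_labels S n p (a', b')" "row_labels S n (Suc p) (a, b)"
    have "S x 2 r2 q2" "S y 3 r3 q3" "S z 1 p q1"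
      using S that by (auto simp: row_labels_def adjacent_def two_def three_def)
    with that show "grid_fair S n (p, q)" by (intro grid_fairI)
  qed
  note ar = adjacent_def two_def three_def
  note R' = R[of i] R[of j] R[of k]
  have "\<exists>x. good x"
  proof (cases "a' k + 2 \<le> b' k")
    case gap: True
    \<comment> \<open>In case 5 some index in the gap of \<open>k\<close> lies between
      \<open>b j\<close> and \<open>Suc (a i)\<close>: \<open>k\<close> takes piece 1 there, and
      \<open>i\<close>, \<open>j\<close> use the upper row. Otherwise that range lies beyond an end
      of the gap. In cases 1 and 2 it is the right end \<open>b' k\<close>: \<open>i\<close> takes
      piece 2 above, and comparing \<open>b' k\<close> with \<open>b' j\<close> decides which of
      \<open>k\<close>, \<open>j\<close> takes piece 3 and which piece 1. Cases 3 and 4 mirror this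
      at \<open>a' k\<close>.\<close>
    consider (1) "b' k \<le> b j" "b' k < b' j" | (2) "b' k \<le> b j" "b' j \<le> b' k"
      | (3) "a i < a' k" "a' i < a' k" | (4) "a i < a' k" "a' k \<le> a' i"
      | (5) "b j < b' k" "a' k \<le> a i"
      by linarith
    then show ?thesis
    proof cases
      case 1
      have "good (p, b' k)"
        using ij k 1 sep' R'
        by (intro goodI[of i k j _ "Suc p" "b' k - 1" p "b' k" "b' k"]) (auto simp: ar)
      then show ?thesis ..
    next
      case 2
      have "good (p, b' k - 1)"
        using ij k 2 sep' R' gap
        by (intro goodI[of i j k _ "Suc p" "b' k - 1" p "b' k" "b' k - 1"]) (auto simp: ar)
      then show ?thesis ..
    next
      case 3
      have "good (p, a' k)"
        using ij k 3 sep' R' gap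
        by (intro goodI[of k j i _ p "a' k" "Suc p" "a' k" "a' k"]) (auto simp: ar)
      then show ?thesis ..
    next
      case 4
      have "good (p, Suc (a' k))"
        using ij k 4 sep' R' gap
        by (intro goodI[of i j k _ p "a' k" "Suc p" "a' k" "Suc (a' k)"]) (auto simp: ar)
      then show ?thesis ..
    next
      case 5
      define q where "q = max (Suc (a' k)) (b j)"
      have q: "a' k < q" "q < b' k" "b j \<le> q" "q \<le> Suc (a i)"
        using 5 gap ij unfolding q_def by auto
      have "good (p, q)"
        using ij k q R'
        by (intro goodI[of i j k _ "Suc p" "q - 1" "Suc p" q q]) (auto simp: ar)
      then show ?thesis ..
    qed
  next
    case nogap: False
    \<comment> \<open>Now \<open>k\<close> takes piece 3 at \<open>b' k\<close> or piece 2 at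
      \<open>a' k\<close>. As \<open>b' k\<close> is at most \<open>Suc (a' k)\<close>,
      \<open>sep\<close> puts both indices inside the gaps of \<open>i\<close> and \<open>j\<close>,
      one of whom takes piece 1.\<close>
    show ?thesis
    proof (cases "b' k \<le> Suc (a i)")
      case True
      have "good (p, b' k)"
        using ij k True sep' R' nogap
        by (intro goodI[of i k j _ "Suc p" "b' k - 1" p "b' k" "b' k"]) (auto simp: ar)
      then show ?thesis ..
    next
      case False
      have "good (p, a' k)"
        using ij k False sep' R' nogap
        by (intro goodI[of k j i _ p "a' k" "Suc p" "a' k" "a' k"]) (auto simp: ar)
      then show ?thesis ..
    qed
  qed
  then show ?thesis unfolding good_def .
qed

section \<open>The triangular grid\<close>

text \<open>Two edge vectors at a vertex have Gram matrix with diagonal 1 and off-diagonal 1/2. It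
  is invertible, so coordinates are unique and the \<open>THE\<close> in \<open>bary\<close> denotes
  them.\<close>

lemma bary_eq:
  assumes "regular_triangle v" and a: "(\<Sum>i\<in>UNIV. a i) = 1"
  shows "bary v (\<Sum>i\<in>UNIV. a i *\<^sub>R v i) = a"
  unfolding bary_def
proof (rule the_equality)
  show "(\<Sum>i\<in>UNIV. a i) = 1 \<and> (\<Sum>i\<in>UNIV. a i *\<^sub>R v i) = (\<Sum>i\<in>UNIV. a i *\<^sub>R v i)"
    using a by simp
next
  fix a' assume a': "(\<Sum>i\<in>UNIV. a' i) = 1 \<and> (\<Sum>i\<in>UNIV. a' i *\<^sub>R v i) = (\<Sum>i\<in>UNIV. a i *\<^sub>R v i)"
  define c where "c = (\<lambda>i. a' i - a i)"
  define x y where "x = v 1 - v 3" and "y = v 2 - v 3"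
  have "norm x = 1" "norm y = 1" "norm (x - y) = 1"
    using assms(1) unfolding regular_triangle_def x_def y_def dist_norm by auto
  then have xx: "x \<bullet> x = 1" and yy: "y \<bullet> y = 1" and "(x - y) \<bullet> (x - y) = 1"
    by (simp_all add: norm_eq_1)
  then have xy: "x \<bullet> y = 1 / 2"
    by (simp add: inner_diff_left inner_diff_right inner_commute)
  have c3: "c 3 = - c 1 - c 2"
    using a a' by (simp add: c_def sum_3)
  have "c 1 *\<^sub>R v 1 + c 2 *\<^sub>R v 2 + c 3 *\<^sub>R v 3 = 0"
    using a' by (simp add: c_def sum_3 algebra_simps)
  then have z: "c 1 *\<^sub>R x + c 2 *\<^sub>R y = 0"
    unfolding c3 x_def y_def by (simp add: algebra_simps)
  have "(c 1 *\<^sub>R x + c 2 *\<^sub>R y) \<bullet> x = 0" "(c 1 *\<^sub>R x + c 2 *\<^sub>R y) \<bullet> y = 0"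
    unfolding z by simp_all
  then have "c 1 + c 2 / 2 = 0" "c 1 / 2 + c 2 = 0"
    using xx yy xy by (simp_all add: inner_add_left inner_commute[of y x])
  then have "c 1 = 0" "c 2 = 0" by linarith+
  then have "c i = 0" for i
    using c3 exhaust_3[of i] by auto
  then show "a' = a" by (simp add: c_def fun_eq_iff)
qed

definition grid_coord :: "nat \<Rightarrow> nat \<Rightarrow> nat \<Rightarrow> 3 \<Rightarrow> real" where
  "grid_coord n p q i =
     (if i = 1 then real p else if i = 2 then real q else real n - real p - real q) / real n"

definition grid_point :: "(3 \<Rightarrow> real^2) \<Rightarrow> nat \<Rightarrow> nat \<Rightarrow> nat \<Rightarrow> real^2" where
  "grid_point v n p q = (\<Sum>i\<in>UNIV. grid_coord n p q i *\<^sub>R v i)"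

lemma grid_coord_nonneg: "p + q \<le> n \<Longrightarrow> 0 \<le> grid_coord n p q i"
  by (auto simp: grid_coord_def)

lemma sum_grid_coord: "n > 0 \<Longrightarrow> (\<Sum>i\<in>UNIV. grid_coord n p q i) = 1"
  by (simp add: grid_coord_def sum_3 add_divide_distrib[symmetric])

lemma grid_point_in_triangle:
  assumes "p + q \<le> n" "n > 0"
  shows "grid_point v n p q \<in> triangle_of v"
  unfolding grid_point_def triangle_of_def
  using assms by (intro convex_sum) (auto simp: sum_grid_coord grid_coord_nonneg hull_inc)

lemma grid_point_in_side:
  assumes "p + q \<le> n" "n > 0" "grid_coord n p q j = 0"
  shows "grid_point v n p q \<in> side v j"
proof -
  have "(\<Sum>i\<in>{k. k \<noteq> j}. grid_coord n p q i) = 1"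
    using assms sum_grid_coord[of n p q] sum.mono_neutral_left[of UNIV "{k. k \<noteq> j}" "grid_coord n p q"]
    by auto
  then have "(\<Sum>i\<in>{k. k \<noteq> j}. grid_coord n p q i *\<^sub>R v i) \<in> side v j"
    unfolding side_def using assms by (intro convex_sum) (auto simp: grid_coord_nonneg hull_inc)
  moreover have "(\<Sum>i\<in>{k. k \<noteq> j}. grid_coord n p q i *\<^sub>R v i) = grid_point v n p q"
    unfolding grid_point_def using assms by (intro sum.mono_neutral_left) auto
  ultimately show ?thesis by simp
qed

text \<open>Along a row the grid point is affine in \<open>q\<close>.\<close>

lemma grid_point_between:
  assumes "convex C" "grid_point v n p q1 \<in> C" "grid_point v n p q2 \<in> C" "q1 \<le> q" "q \<le> q2"
  shows "grid_point v n p q \<in> C"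
proof (cases "q1 = q2")
  case True
  then show ?thesis using assms by auto
next
  case False
  define u where "u = (real q - real q1) / (real q2 - real q1)"
  have "u * (real q2 - real q1) = real q - real q1"
    using False by (simp add: u_def)
  then have "real q = (1 - u) * real q1 + u * real q2"
    by (simp add: algebra_simps)
  moreover have "0 \<le> u" "u \<le> 1"
    using assms(4,5) False unfolding u_def by auto
  ultimately have u: "0 \<le> u" "u \<le> 1" "real q = (1 - u) * real q1 + u * real q2"
    by blast+
  have "grid_coord n p q i = (1 - u) * grid_coord n p q1 i + u * grid_coord n p q2 i" for i
    unfolding grid_coord_def u(3) by (simp add: algebra_simps add_divide_distrib diff_divide_distrib)
  then have "grid_point v n p q = (1 - u) *\<^sub>R grid_point v n p q1 + u *\<^sub>R grid_point v n p q2"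
    unfolding grid_point_def by (simp add: scaleR_add_left sum.distrib scaleR_sum_right)
  then show ?thesis
    using convexD_alt[OF assms(1-3) u(1,2)] by simp
qed

lemma bdist_adjacent:
  assumes "regular_triangle v" "n > 0" "adjacent n (p, q) (p', q')"
  shows "bdist v (grid_point v n p q) (grid_point v n p' q') \<le> 1 / real n"
proof -
  have "\<bar>grid_coord n p q i - grid_coord n p' q' i\<bar> \<le> 1 / real n" for i
  proof -
    have "\<bar>real p - real p'\<bar> \<le> 1" "\<bar>real q - real q'\<bar> \<le> 1"
      "\<bar>(real n - real p - real q) - (real n - real p' - real q')\<bar> \<le> 1"
      using assms(3) unfolding adjacent_def by auto
    then show ?thesis
      unfolding grid_coord_def
      by (simp add: diff_divide_distrib[symmetric] abs_divide divide_right_mono)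
  qed
  then show ?thesis
    using assms unfolding bdist_def grid_point_def by (simp add: bary_eq sum_grid_coord)
qed

lemma in_neighbourhood:
  assumes "y \<in> C" "bdist v x y \<le> \<epsilon>"
  shows "x \<in> neighbourhood v \<epsilon> C"
proof -
  have "0 \<le> bdist v x z" for z
    unfolding bdist_def by (rule order_trans[OF _ Max_ge[of _ "\<bar>bary v x 1 - bary v z 1\<bar>"]]) auto
  then have "bdd_below (bdist v x ` C)"
    by (auto intro!: bdd_belowI[of _ 0])
  then have "(INF z\<in>C. bdist v x z) \<le> bdist v x y"
    using assms(1) by (rule cINF_lower)
  then show ?thesis
    using assms unfolding neighbourhood_def by auto
qed

lemma permutation_3:
  fixes i j k l m r :: 3
  assumes "i \<noteq> j" "i \<noteq> k" "j \<noteq> k" "l \<noteq> m" "l \<noteq> r" "m \<noteq> r"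
  obtains \<sigma> where "\<sigma> permutes UNIV" "\<sigma> i = l" "\<sigma> j = m" "\<sigma> k = r" "\<And>x. x = i \<or> x = j \<or> x = k"
proof
  define \<sigma> where "\<sigma> = (\<lambda>x. if x = i then l else if x = j then m else r)"
  have "card {i, j, k} = CARD(3)" using assms by simp
  then have U: "{i, j, k} = UNIV" by (intro card_subset_eq) auto
  then show *: "x = i \<or> x = j \<or> x = k" for x by auto
  show "\<sigma> i = l" "\<sigma> j = m" "\<sigma> k = r" using assms by (auto simp: \<sigma>_def)
  have "inj \<sigma>"
  proof (rule injI)
    fix x y assume "\<sigma> x = \<sigma> y"
    then show "x = y" using assms *[of x] *[of y] by (auto simp: \<sigma>_def)
  qed
  then have "bij \<sigma>" by (simp add: bij_betw_def finite_UNIV_inj_surj)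
  then show "\<sigma> permutes UNIV" by (auto intro: bij_imp_permutes)
qed

lemma grid_fair_imp_fair:
  assumes v: "regular_triangle v" and n: "n > 0" "1 / real n \<le> \<epsilon>" and x: "p + q \<le> n"
    and "grid_fair (\<lambda>i j p q. grid_point v n p q \<in> P i j) n (p, q)"
  shows "fair_division_point v P \<epsilon> (grid_point v n p q)"
proof -
  have nb: "grid_point v n p q \<in> neighbourhood v \<epsilon> (P i j)"
    if "\<exists>p' q'. adjacent n (p, q) (p', q') \<and> grid_point v n p' q' \<in> P i j" for i j
    using that bdist_adjacent[OF v n(1)] n(2) in_neighbourhood order_trans by meson
  obtain i j k where ijk: "i \<noteq> j" "i \<noteq> k" "j \<noteq> k" and
    y: "grid_point v n p q \<in> neighbourhood v \<epsilon> (P i 2)"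
       "grid_point v n p q \<in> neighbourhood v \<epsilon> (P j 3)"
       "grid_point v n p q \<in> neighbourhood v \<epsilon> (P k 1)"
    using assms(5) nb unfolding grid_fair_def by blast
  obtain \<sigma> where \<sigma>: "\<sigma> permutes UNIV" "\<sigma> i = 2" "\<sigma> j = 3" "\<sigma> k = 1"
      and all: "\<And>x. x = i \<or> x = j \<or> x = k"
    by (rule permutation_3[OF ijk, of 2 3 1]) auto
  have "grid_point v n p q \<in> neighbourhood v \<epsilon> (P x (\<sigma> x))" for x
    using all[of x] y \<sigma>(2-4) by (elim disjE) simp_all
  then show ?thesis
    unfolding fair_division_point_def using \<sigma>(1) grid_point_in_triangle[OF x n(1)] by blast
qed

section \<open>Querying a row\<close>

text \<open>Index 0 enters as a known yes and \<open>Suc m\<close> as a sentinel no; neither is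
  probed.\<close>

definition last_yes :: "(nat \<Rightarrow> bool) \<Rightarrow> nat \<Rightarrow> nat" where
  "last_yes t m = fst (bisect id t 0 True (Suc m) False)"

lemma last_yes:
  assumes "t 0" and "\<And>q q'. q \<le> m \<Longrightarrow> t q \<Longrightarrow> q' \<le> q \<Longrightarrow> t q'"
  shows "last_yes t m \<le> m" and "q \<le> m \<Longrightarrow> t q \<longleftrightarrow> q \<le> last_yes t m"
proof -
  obtain s b c where e: "bisect id t 0 True (Suc m) False = (s, b, c)"
    by (metis prod_cases3)
  \<comment> \<open>\<open>J\<close> carries the guard \<open>q \<le> m\<close> because the sentinel
    lies beyond the row, where \<open>t\<close> is arbitrary.\<close>
  have "0 \<le> s \<and> s < Suc m \<and> t s \<and> (Suc s \<le> m \<longrightarrow> \<not> t (Suc s))"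
    by (rule bisect_invariant[where I = "\<lambda>q _. t q" and J = "\<lambda>q _. q \<le> m \<longrightarrow> \<not> t q", OF _ _ _ _ _ e])
      (use assms(1) in auto)
  moreover have "last_yes t m = s" by (simp add: last_yes_def e)
  ultimately have s: "last_yes t m \<le> m" "t (last_yes t m)"
      "Suc (last_yes t m) \<le> m \<Longrightarrow> \<not> t (Suc (last_yes t m))"
    by auto
  then show "last_yes t m \<le> m" by blast
  show "t q \<longleftrightarrow> q \<le> last_yes t m" if "q \<le> m"
  proof (cases "q \<le> last_yes t m")
    case True
    then show ?thesis using assms(2)[OF s(1,2)] by blast
  next
    case False
    then show ?thesis using s(3) assms(2)[OF that, of "Suc (last_yes t m)"] that by auto
  qed
qed

lemma computable_last_yes:
  assumes "m < 2 ^ L" "\<And>q. q \<le> m \<Longrightarrow> computable A 1 (t q)"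
  shows "computable A L (\<lambda>P. last_yes (\<lambda>q. t q P) m)"
  unfolding last_yes_def
proof (rule computable_map[where h = fst])
  have "computable A (L * 1) (\<lambda>P. bisect id (\<lambda>q. t q P) 0 True (Suc m) False)"
    using assms by (intro computable_bisect) auto
  then show "computable A L (\<lambda>P. bisect id (\<lambda>q. t q P) 0 True (Suc m) False)"
    by simp
qed

text \<open>Piece 3 is searched from the other end of the row, where \<open>F\<^sub>3\<close> lies.\<close>

definition row_info ::
    "(3 \<Rightarrow> real^2) \<Rightarrow> nat \<Rightarrow> nat \<Rightarrow> (3 \<Rightarrow> 3 \<Rightarrow> (real^2) set) \<Rightarrow> (3 \<Rightarrow> nat) \<times> (3 \<Rightarrow> nat)" where
  "row_info v n p P =
     (\<lambda>i. last_yes (\<lambda>q. grid_point v n p q \<in> P i 2) (n - p),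
      \<lambda>i. n - p - last_yes (\<lambda>r. grid_point v n p (n - p - r) \<in> P i 3) (n - p))"

lemma computable_row_info:
  assumes "0 < p" "p \<le> n" "n \<le> 2 ^ L"
  shows "computable (triangle_of v) (6 * L) (row_info v n p)"
proof -
  \<comment> \<open>As \<open>p > 0\<close>, the row has at most \<open>n\<close> points, so
    \<open>L\<close> probes per bisection suffice; row 0 with \<open>n = 2 ^ L\<close> would exceed
    this.\<close>
  have L: "n - p < 2 ^ L" using assms by linarith
  have "computable (triangle_of v) (3 * L + 3 * L) (\<lambda>P. row_info v n p P)"
    unfolding row_info_def using assms
    by (intro computable_Pair computable_fun3 computable_last_yes[OF L]
        computable_map[where h = "\<lambda>x. n - p - x"] computable_query grid_point_in_triangle) auto
  then show ?thesis by simp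
qed

text \<open>The row starts on the side opposite \<open>v 2\<close> and ends on the side opposite
  \<open>v 3\<close>, so convexity makes the answers for pieces 2 and 3 monotone. In between, the
  covering property leaves only piece 1.\<close>

lemma row_labels_row_info:
  assumes P: "preference_sets v P" "\<And>i j. convex (P i j)" "\<And>i j. side v j \<subseteq> P i j"
    and p: "0 < p" "p \<le> n"
  shows "row_labels (\<lambda>i j p q. grid_point v n p q \<in> P i j) n p (row_info v n p P)"
proof -
  have s2: "grid_point v n p 0 \<in> P i 2" for i
    using p P(3) grid_point_in_side[of p 0 n 2 v] by (auto simp: grid_coord_def)
  have s3: "grid_point v n p (n - p) \<in> P i 3" for i
    using p P(3) grid_point_in_side[of p "n - p" n 3 v] by (auto simp: grid_coord_def)
  have d2: "grid_point v n p q' \<in> P i 2" if "grid_point v n p q \<in> P i 2" "q' \<le> q" for i q q'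
    using grid_point_between[OF P(2) s2 that(1)] that(2) by simp
  have d3: "grid_point v n p q' \<in> P i 3" if "grid_point v n p q \<in> P i 3" "q \<le> q'" "q' \<le> n - p" for i q q'
    using grid_point_between[OF P(2) that(1) s3] that(2,3) by simp
  define a where "a = (\<lambda>i. last_yes (\<lambda>q. grid_point v n p q \<in> P i 2) (n - p))"
  define c where "c = (\<lambda>i. last_yes (\<lambda>r. grid_point v n p (n - p - r) \<in> P i 3) (n - p))"
  have a: "a i \<le> n - p" "q \<le> n - p \<Longrightarrow> grid_point v n p q \<in> P i 2 \<longleftrightarrow> q \<le> a i" for i q
    unfolding a_def using last_yes[of "\<lambda>q. grid_point v n p q \<in> P i 2" "n - p"] s2 d2 by blast+
  have c: "c i \<le> n - p" "r \<le> n - p \<Longrightarrow> grid_point v n p (n - p - r) \<in> P i 3 \<longleftrightarrow> r \<le> c i" for i r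
    unfolding c_def using last_yes[of "\<lambda>r. grid_point v n p (n - p - r) \<in> P i 3" "n - p"] s3 d3
    by (auto simp: diff_le_mono2)
  have b: "grid_point v n p q \<in> P i 3 \<longleftrightarrow> n - p - c i \<le> q" if "q \<le> n - p" for i q
  proof -
    \<comment> \<open>Subtraction truncates, so reversing the row is an involution only for
      \<open>q \<le> n - p\<close>.\<close>
    have "n - p - (n - p - q) = q" using that by simp
    then show ?thesis using c(2)[of "n - p - q" i] c(1)[of i] that by auto
  qed
  have "grid_point v n p q \<in> P i 1" if "q \<le> n - p" "\<not> q \<le> a i" "\<not> n - p - c i \<le> q" for i q
  proof -
    have "grid_point v n p q \<in> (\<Union>j. P i j)"
      using P(1) grid_point_in_triangle[of p q n v] p that(1) unfolding preference_sets_def by auto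
    then obtain j where "grid_point v n p q \<in> P i j" by auto
    then show ?thesis using exhaust_3[of j] a(2) b that by auto
  qed
  moreover have "p + a i \<le> n" "p + (n - p - c i) \<le> n" for i
    using a(1)[of i] p by auto
  moreover have "row_info v n p P = (a, \<lambda>i. n - p - c i)"
    by (simp add: row_info_def a_def c_def)
  ultimately show ?thesis
    using a(2) b unfolding row_labels_def by (auto simp: not_le)
qed

text \<open>On the side \<open>F\<^sub>1\<close> these labels hold for every collection, although \<open>row_info\<close> may give other
  ones; they make row \<open>0\<close> incompatible as soon as \<open>n \<ge> 2\<close>.\<close>

lemma row_labels_bottom:
  assumes P: "\<And>i j. side v j \<subseteq> P i j" and n: "n > 0"
  shows "row_labels (\<lambda>i j p q. grid_point v n p q \<in> P i j) n 0 (\<lambda>i. 0, \<lambda>i. n)"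
proof -
  have "grid_point v n 0 0 \<in> P i 2" "grid_point v n 0 n \<in> P i 3" for i
    using P n grid_point_in_side[of 0 0 n 2 v] grid_point_in_side[of 0 n n 3 v]
    by (auto simp: grid_coord_def)
  moreover have "q \<le> n \<Longrightarrow> grid_point v n 0 q \<in> P i 1" for i q
    using P n grid_point_in_side[of 0 q n 1 v] by (auto simp: grid_coord_def)
  ultimately show ?thesis unfolding row_labels_def by auto
qed

text \<open>Row \<open>n\<close> is the single vertex \<open>v 1\<close>, which lies on the sides
  opposite \<open>v 2\<close> and \<open>v 3\<close>, so its labels cost no queries.\<close>

lemma row_labels_top:
  assumes P: "\<And>i j. side v j \<subseteq> P i j" and n: "n > 0"
  shows "row_labels (\<lambda>i j p q. grid_point v n p q \<in> P i j) n n (\<lambda>i. 0, \<lambda>i. 0)"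
proof -
  have "grid_point v n n 0 \<in> P i 2" "grid_point v n n 0 \<in> P i 3" for i
    using P n grid_point_in_side[of n 0 n 2 v] grid_point_in_side[of n 0 n 3 v]
    by (auto simp: grid_coord_def)
  then show ?thesis unfolding row_labels_def by auto
qed

section \<open>The search over rows and the query bound\<close>

lemma computable_fair_point:
  assumes v: "regular_triangle v" and n: "2 \<le> n" "1 / real n \<le> \<epsilon>" "n \<le> 2 ^ L"
  shows "\<exists>f. computable (triangle_of v) (L * (6 * L)) f \<and> (\<forall>P. fst (f P) + snd (f P) \<le> n) \<and>
    (\<forall>P. preference_sets v P \<and> (\<forall>i j. convex (P i j) \<and> side v j \<subseteq> P i j) \<longrightarrow>
       fair_division_point v P \<epsilon> (grid_point v n (fst (f P)) (snd (f P))))"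
proof -
  define search where "search = (\<lambda>P. bisect (\<lambda>r. \<not> compatible r) (\<lambda>p. row_info v n p P)
    0 (\<lambda>i. 0, \<lambda>i. n) n (\<lambda>i. 0, \<lambda>i. 0))"
  \<comment> \<open>The output may depend on \<open>P\<close> only through the outcome of the
    search, so \<open>pick\<close> is chosen once for all outcomes. It yields a grid point even for
    outcomes that carry no information.\<close>
  define good where "good = (\<lambda>(p, r', r) x. fst x + snd x \<le> n \<and>
    (\<not> compatible r' \<longrightarrow> compatible r \<longrightarrow>
      (\<forall>S. row_labels S n p r' \<longrightarrow> row_labels S n (Suc p) r \<longrightarrow> grid_fair S n x)))"
  have "\<exists>x. good z x" for z
  proof -
    obtain p a' b' a b where z: "z = (p, (a', b'), (a, b))" by (metis prod_cases3 surj_pair)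
    show ?thesis
    proof (cases "\<not> compatible (a', b') \<and> compatible (a, b)")
      case True
      then show ?thesis using strip_fair[of a' b' a b n p] by (auto simp: good_def z)
    next
      case False
      then show ?thesis by (intro exI[of _ "(0, 0)"]) (auto simp: good_def z)
    qed
  qed
  then obtain pick where pick: "\<And>z. good z (pick z)" by metis
  have "computable (triangle_of v) (L * (6 * L)) search"
    unfolding search_def using n computable_row_info by (intro computable_bisect) auto
  then have 1: "computable (triangle_of v) (L * (6 * L)) (\<lambda>P. pick (search P))"
    by (rule computable_map)
  have 2: "fst (pick z) + snd (pick z) \<le> n" for z
    using pick[of z] by (auto simp: good_def)
  have 3: "fair_division_point v P \<epsilon> (grid_point v n (fst (pick (search P))) (snd (pick (search P))))"
    if P: "preference_sets v P \<and> (\<forall>i j. convex (P i j) \<and> side v j \<subseteq> P i j)" for P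
  proof -
    define S where "S = (\<lambda>i j p q. grid_point v n p q \<in> P i j)"
    obtain s r' r where e: "search P = (s, r', r)" by (metis prod_cases3)
    have lab: "row_labels S n p (row_info v n p P)" if "0 < p" "p < n" for p
      unfolding S_def using P that by (intro row_labels_row_info) auto
    have "0 \<le> s \<and> s < n \<and> (row_labels S n s r' \<and> \<not> compatible r') \<and>
        (row_labels S n (Suc s) r \<and> compatible r)"
    proof (rule bisect_invariant[where I = "\<lambda>p r. row_labels S n p r \<and> \<not> compatible r"
          and J = "\<lambda>p r. row_labels S n p r \<and> compatible r", OF _ _ _ _ _ e[unfolded search_def]])
      show "row_labels S n 0 (\<lambda>i. 0, \<lambda>i. n) \<and> \<not> compatible (\<lambda>i. 0, \<lambda>i. n)"
        unfolding S_def using P n row_labels_bottom[of v P n] by (auto simp: compatible_def)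
      have "(1 :: 3) \<noteq> 2" by simp
      then have "compatible (\<lambda>i. 0, \<lambda>i. 0)" unfolding compatible_def by blast
      then show "row_labels S n n (\<lambda>i. 0, \<lambda>i. 0) \<and> compatible (\<lambda>i. 0, \<lambda>i. 0)"
        unfolding S_def using P n row_labels_top[of v P n] by auto
    qed (use lab n in auto)
    then have "grid_fair S n (pick (search P))"
      using pick[of "search P"] by (simp add: good_def e)
    then show ?thesis
      using grid_fair_imp_fair[OF v _ n(2) 2] n(1) unfolding S_def by auto
  qed
  show ?thesis using 1 2 3 by (intro exI[of _ "\<lambda>P. pick (search P)"]) auto
qed

text \<open>For \<open>n = 1\<close> the bound allows no query. The output is \<open>v 3\<close>, on
  the sides opposite \<open>v 1\<close> and \<open>v 2\<close>; at distance 1 is \<open>v 2\<close>,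
  on the side opposite \<open>v 3\<close>.\<close>

lemma fair_point_trivial:
  assumes "regular_triangle v" "1 \<le> \<epsilon>" and P: "\<And>i j. side v j \<subseteq> P i j"
  shows "fair_division_point v P \<epsilon> (grid_point v 1 0 0)"
proof -
  have "row_labels (\<lambda>i j p q. grid_point v 1 p q \<in> P i j) 1 0 (\<lambda>i. 0, \<lambda>i. 1)"
    using row_labels_bottom[OF P, of 1] by simp
  moreover have "grid_point v 1 0 0 \<in> P 3 1"
    using P grid_point_in_side[of 0 0 1 1 v] by (auto simp: grid_coord_def)
  ultimately have "grid_fair (\<lambda>i j p q. grid_point v 1 p q \<in> P i j) 1 (0, 0)"
    by (intro grid_fairI[of 1 2 3 1 _ 0 0 _ 0 1 0 0]) (auto simp: row_labels_def adjacent_def)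
  then show ?thesis using assms by (intro grid_fair_imp_fair) auto
qed

lemma log_count_bigo:
  "(\<lambda>m::nat. real_of_int (6 * (\<lceil>log 2 (real m)\<rceil>\<^sup>2 + \<lceil>log 2 (real m)\<rceil>))) \<in> O(\<lambda>m. (ln (real m))\<^sup>2)"
proof (rule bigoI[of _ "36 / (ln 2)\<^sup>2"])
  show "\<forall>\<^sub>F m in sequentially. norm (real_of_int (6 * (\<lceil>log 2 (real m)\<rceil>\<^sup>2 + \<lceil>log 2 (real m)\<rceil>)))
          \<le> 36 / (ln 2)\<^sup>2 * norm ((ln (real m))\<^sup>2)"
    using eventually_ge_at_top[of 2]
  proof eventually_elim
    case (elim m)
    define l where "l = log 2 (real m)"
    \<comment> \<open>With \<open>l\<close> at least 1, its ceiling is at most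
      \<open>l + 1 \<le> 2 * l\<close>, and \<open>6 * (4 + 2) = 36\<close> gives the
      constant.\<close>
    have l: "1 \<le> l" using elim by (simp add: l_def)
    have c: "0 \<le> real_of_int \<lceil>l\<rceil>" "real_of_int \<lceil>l\<rceil> \<le> 2 * l" using l by linarith+
    have "real_of_int \<lceil>l\<rceil> ^ 2 \<le> (2 * l)\<^sup>2" using c by (intro power_mono) auto
    moreover have "2 * l \<le> 2 * l\<^sup>2" using l by (simp add: power2_eq_square)
    ultimately have "6 * (real_of_int \<lceil>l\<rceil> ^ 2 + real_of_int \<lceil>l\<rceil>) \<le> 36 * l\<^sup>2"
      using c by (simp add: power2_eq_square)
    also have "\<dots> = 36 / (ln 2)\<^sup>2 * (ln (real m))\<^sup>2"
      by (simp add: l_def log_def power_divide)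
    finally show ?case
      using c unfolding l_def by simp
  qed
qed

theorem theorem5p2:
  fixes v :: "3 \<Rightarrow> real^2" and \<epsilon> :: real and n :: nat
  assumes "regular_triangle v"
    and "\<epsilon> > 0"
    and "int n = \<lceil>1 / \<epsilon>\<rceil>"
  shows "(\<exists>alg. points_in (triangle_of v) alg \<and>
            (\<forall>P. preference_sets v P \<and> (\<forall>i j. convex (P i j) \<and> side v j \<subseteq> P i j) \<longrightarrow>
                 int (num_queries P alg) \<le> 6 * (\<lceil>log 2 (real n)\<rceil>\<^sup>2 + \<lceil>log 2 (real n)\<rceil>) \<and>
                 fair_division_point v P \<epsilon> (run P alg)))
       \<and> (\<lambda>m::nat. real_of_int (6 * (\<lceil>log 2 (real m)\<rceil>\<^sup>2 + \<lceil>log 2 (real m)\<rceil>)))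
            \<in> O(\<lambda>m. (ln (real m))\<^sup>2)"
proof (rule conjI[OF _ log_count_bigo])
  have "0 < 1 / \<epsilon>" using assms(2) by simp
  then have n: "0 < n" using assms(3) by linarith
  have "1 / \<epsilon> \<le> real n" using assms(3) by linarith
  then have eps: "1 / real n \<le> \<epsilon>"
    using n assms(2) by (simp add: field_simps)
  let ?bound = "6 * (\<lceil>log 2 (real n)\<rceil>\<^sup>2 + \<lceil>log 2 (real n)\<rceil>)"
  show "\<exists>alg. points_in (triangle_of v) alg \<and>
            (\<forall>P. preference_sets v P \<and> (\<forall>i j. convex (P i j) \<and> side v j \<subseteq> P i j) \<longrightarrow>
                 int (num_queries P alg) \<le> ?bound \<and> fair_division_point v P \<epsilon> (run P alg))"
  proof (cases "n = 1")
    case True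
    then show ?thesis
      using eps fair_point_trivial[OF assms(1)] grid_point_in_triangle[of 0 0 1 v]
      by (intro exI[of _ "Output (grid_point v 1 0 0)"]) auto
  next
    case False
    define L where "L = nat \<lceil>log 2 (real n)\<rceil>"
    have "0 \<le> log 2 (real n)" using n by simp
    then have L: "\<lceil>log 2 (real n)\<rceil> = int L" by (simp add: L_def)
    then have "log 2 (real n) \<le> real L" by linarith
    then have "real n \<le> 2 ^ L" using n by (simp add: log_le_iff powr_realpow)
    then have "n \<le> 2 ^ L" by (metis of_nat_le_iff of_nat_numeral of_nat_power)
    then obtain f where f: "computable (triangle_of v) (L * (6 * L)) f"
        "\<And>P. fst (f P) + snd (f P) \<le> n"
        "\<And>P. preference_sets v P \<and> (\<forall>i j. convex (P i j) \<and> side v j \<subseteq> P i j) \<Longrightarrow>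
           fair_division_point v P \<epsilon> (grid_point v n (fst (f P)) (snd (f P)))"
      using computable_fair_point[OF assms(1) _ eps, of L] n False by force
    \<comment> \<open>A continuation must output points of the triangle for every argument; the
      \<open>else\<close> branch is a default that values of \<open>f\<close> never reach.\<close>
    define c where "c = (\<lambda>x. Output (if fst x + snd x \<le> n then grid_point v n (fst x) (snd x)
      else grid_point v n 0 0))"
    have "points_in (triangle_of v) (c x)" for x
      using n grid_point_in_triangle by (auto simp: c_def)
    then obtain alg where "points_in (triangle_of v) alg" "\<And>P. run P alg = run P (c (f P))"
        "\<And>P. num_queries P alg \<le> L * (6 * L) + num_queries P (c (f P))"
      using f(1) unfolding computable_def by meson
    moreover have "int (L * (6 * L)) \<le> ?bound" unfolding L by (simp add: power2_eq_square)
    ultimately show ?thesis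
      using f(2,3) order_trans[OF of_nat_mono] by (intro exI[of _ alg]) (fastforce simp: c_def)
  qed
qed

end
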